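(* Let $n$ be an integer with $n\ge 4$ and let $k\in\{2,3,\ldots,\lfloor n/2\rfloor\}$. Then $$\binom nk<e^{-\frac {11(k-1)}{12n^2}}\frac{n(n-1)^{n-1}}{k^k(n-k)^{n-k}} <\Big(1-\frac{5(k-1)}{6n^2}\Big) \frac{n(n-1)^{n-1}}{k^k(n-k)^{n-k}}.$$
   Context: $\lfloor x\rfloor$ denotes the greatest integer not exceeding $x$. *)

theory Defs
  imports Complex_Main
begin

end

theory Submission
  imports Defs "HOL-Analysis.Harmonic_Numbers"
begin

text \<open>
  Put \<open>E(x) = (1 + 1/x)^x\<close> and \<open>a(k) = binom(n,k) k^k (n-k)^(n-k)\<close>. Then
  \<open>a(1) = n (n-1)^(n-1)\<close> and \<open>a(k+1) / a(k) = E(k) / E(m)\<close> with \<open>m = n-k-1\<close>. The function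
  \<open>x ln (1 + 1/x) + 1 / (2 (2x+1))\<close> is increasing, so for \<open>k < m\<close>
  \<open>ln E(m) - ln E(k) \<ge> (m-k) / ((2k+1) (2m+1)) \<ge> 1/n^2\<close>, the last step being AM-GM for
  \<open>(2k+1) + (2m+1) = 2n\<close>. Multiplying the ratios gives even \<open>a(k) \<le> exp(-(k-1)/n^2) a(1)\<close>.
\<close>

text \<open>The derivative is \<open>ln (1 + 1 / t) - 1 / (t + 1) - 1 / (2 * t + 1)\<^sup>2\<close>.
  It is nonnegative because the logarithm is at least \<open>2 / (2 * t + 1)\<close>, which exceeds
  \<open>1 / (t + 1)\<close> by \<open>1 / ((t + 1) * (2 * t + 1))\<close>.\<close>

lemma ln_Euler_correction_mono:
  fixes x y :: real
  assumes "0 < x" "x \<le> y"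
  shows "x * ln (1 + 1 / x) + 1 / (2 * (2 * x + 1)) \<le> y * ln (1 + 1 / y) + 1 / (2 * (2 * y + 1))"
proof (rule DERIV_nonneg_imp_nondecreasing[OF assms(2)])
  fix t assume "x \<le> t" "t \<le> y"
  with assms have t: "t > 0" by simp
  let ?d = "ln (1 + 1 / t) - 1 / (t + 1) - 1 / (2 * t + 1)\<^sup>2"
  have "0 < 1 + 1 / t" using t by (simp add: add_pos_pos)
  then have "((\<lambda>t. t * ln (1 + 1 / t) + 1 / (2 * (2 * t + 1))) has_real_derivative
      (ln (1 + 1 / t) + t * (- (1 / t\<^sup>2) / (1 + 1 / t)) - 4 / (4 * t + 2)\<^sup>2)) (at t)"
    using t by (auto intro!: derivative_eq_intros simp: power2_eq_square mult.commute)
  moreover have "4 / (4 * t + 2)\<^sup>2 = 1 / (2 * t + 1)\<^sup>2"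
    using t by (simp add: divide_simps power2_eq_square) (simp add: algebra_simps)
  moreover have "t * (- (1 / t\<^sup>2) / (1 + 1 / t)) = - (1 / (t + 1))"
    using t by (simp add: divide_simps power2_eq_square)
  ultimately have "((\<lambda>t. t * ln (1 + 1 / t) + 1 / (2 * (2 * t + 1))) has_real_derivative ?d) (at t)"
    by simp
  moreover have "?d \<ge> 0"
  proof -
    have "1 / (t + 1) + 1 / (2 * t + 1)\<^sup>2 \<le> 2 / (2 * t + 1)"
      using t by (simp add: divide_simps power2_eq_square) (simp add: algebra_simps)
    \<comment> \<open>Midpoint bound for the convex function \<open>1 / x\<close>, integrated over
      the interval from \<open>t\<close> to \<open>t + 1\<close>.\<close>
    also have "\<dots> \<le> ln (t + 1) - ln t"
      using ln_inverse_approx_ge[of t "t + 1"] t by (simp add: add.commute field_simps)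
    also have "\<dots> = ln (1 + 1 / t)"
      using ln_div[of "t + 1" t] t by (simp add: add_divide_distrib)
    finally show ?thesis by simp
  qed
  ultimately show "\<exists>d. ((\<lambda>t. t * ln (1 + 1 / t) + 1 / (2 * (2 * t + 1))) has_real_derivative d) (at t) \<and> 0 \<le> d"
    by blast
qed

lemma Euler_power_gap:
  fixes k m :: nat
  assumes "0 < k" "k < m"
  shows "exp (1 / (real (k + m + 1))\<^sup>2) * (1 + 1 / real k) ^ k \<le> (1 + 1 / real m) ^ m"
proof -
  have pos: "0 < 1 + 1 / real j" if "0 < j" for j using that by (simp add: add_pos_pos)
  have "1 / (real (k + m + 1))\<^sup>2 \<le> 1 / ((2 * real k + 1) * (2 * real m + 1))"
  proof (rule frac_le)
    show "(2 * real k + 1) * (2 * real m + 1) \<le> (real (k + m + 1))\<^sup>2"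
      using zero_le_power2[of "real m - real k"] by (simp add: power2_eq_square algebra_simps)
    show "0 < (2 * real k + 1) * (2 * real m + 1)"
      by (intro mult_pos_pos) auto
  qed simp_all
  \<comment> \<open>Here integrality enters: \<open>k < m\<close> gives
    \<open>m - k \<ge> 1\<close>. The enlarged numerator makes the fraction split into a difference
    of the two correction terms.\<close>
  also have "\<dots> \<le> (real m - real k) / ((2 * real k + 1) * (2 * real m + 1))"
    using assms by (intro divide_right_mono) auto
  also have "\<dots> = 1 / (2 * (2 * real k + 1)) - 1 / (2 * (2 * real m + 1))"
    by (simp add: divide_simps) (simp add: algebra_simps)
  also have "\<dots> \<le> real m * ln (1 + 1 / real m) - real k * ln (1 + 1 / real k)"
    using ln_Euler_correction_mono[of "real k" "real m"] assms by simp
  finally have "1 / (real (k + m + 1))\<^sup>2 + real k * ln (1 + 1 / real k)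
      \<le> real m * ln (1 + 1 / real m)" by linarith
  then have "exp (1 / (real (k + m + 1))\<^sup>2 + real k * ln (1 + 1 / real k))
      \<le> exp (real m * ln (1 + 1 / real m))" by (simp only: exp_le_cancel_iff)
  then show ?thesis
    using pos[of k] pos[of m] assms by (simp add: exp_add exp_of_nat_mult)
qed

text \<open>The ratio of consecutive weights for \<open>n = k + m + 1\<close>, cross-multiplied to
  avoid quotients. It combines \<open>(k + 1) * (n choose (k + 1)) = (m + 1) * (n choose k)\<close>
  with the identity \<open>E\<close>, which turns \<open>j ^ j\<close> into
  \<open>(j + 1) ^ j\<close>.\<close>

lemma binomial_weight_step:
  fixes k m :: nat
  assumes "0 < k" "0 < m"
  shows "real ((k + m + 1) choose (k + 1)) * real (k + 1) ^ (k + 1) * real m ^ m * (1 + 1 / real m) ^ m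
    = real ((k + m + 1) choose k) * real k ^ k * real (m + 1) ^ (m + 1) * (1 + 1 / real k) ^ k"
proof -
  have E: "real j ^ j * (1 + 1 / real j) ^ j = real (j + 1) ^ j" if "0 < j" for j :: nat
    using that by (simp add: power_mult_distrib[symmetric] distrib_left add.commute)
  have "(k + 1) * ((k + m + 1) choose (k + 1)) = (m + 1) * ((k + m + 1) choose k)"
    using binomial_absorb_comp[of "k + m + 1" k] binomial_absorption[of k "k + m + 1"] by simp
  then have c: "real (k + 1) * real ((k + m + 1) choose (k + 1))
      = real (m + 1) * real ((k + m + 1) choose k)"
    by (simp only: of_nat_mult[symmetric])
  have "real ((k + m + 1) choose (k + 1)) * real (k + 1) ^ (k + 1) * real m ^ m * (1 + 1 / real m) ^ m
     = (real (k + 1) * real ((k + m + 1) choose (k + 1))) * real (k + 1) ^ k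
        * (real m ^ m * (1 + 1 / real m) ^ m)"
    by (simp only: power_add power_one_right ac_simps)
  also have "\<dots> = (real (m + 1) * real ((k + m + 1) choose k)) *
      (real k ^ k * (1 + 1 / real k) ^ k) * real (m + 1) ^ m"
    by (simp only: c E[OF assms(1)] E[OF assms(2)])
  finally show ?thesis
    by (simp only: power_add power_one_right ac_simps)
qed

text \<open>Induction from \<open>k = 1\<close>, where both sides agree. Every step gains the same
  factor \<open>exp (- 1 / n\<^sup>2)\<close>, since the bound on the gap depends only on
  \<open>n\<close>.\<close>

lemma binomial_weight_bound:
  fixes n k :: nat
  assumes "1 \<le> k" "2 * k \<le> n"
  shows "real (n choose k) * real k ^ k * real (n - k) ^ (n - k)
    \<le> exp (- ((real k - 1) / (real n)\<^sup>2)) * (real n * real (n - 1) ^ (n - 1))"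
  using assms
proof (induction k rule: dec_induct)
  case base
  show ?case by simp
next
  case (step k)
  define m where "m = n - Suc k"
  \<comment> \<open>The induction only passes through values with
    \<open>2 * (k + 1) \<le> n\<close>, which is exactly \<open>k < m\<close>.\<close>
  have m: "k < m" "n = k + m + 1" "n - k = m + 1" using step.prems step.hyps by (auto simp: m_def)
  let ?a = "real (n choose k) * real k ^ k * real (n - k) ^ (n - k)"
  let ?b = "real (n choose Suc k) * real (Suc k) ^ Suc k * real (n - Suc k) ^ (n - Suc k)"
  let ?C = "real n * real (n - 1) ^ (n - 1)"
  let ?Ek = "(1 + 1 / real k) ^ k" and ?Em = "(1 + 1 / real m) ^ m"
  have k: "0 < k" using step.hyps by simp
  have Epos: "0 < ?Ek" using k by (intro zero_less_power add_pos_nonneg) auto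
  have gap: "exp (1 / (real n)\<^sup>2) * ?Ek \<le> ?Em"
    using Euler_power_gap[OF k m(1)] by (simp add: m(2))
  have "?b * (exp (1 / (real n)\<^sup>2) * ?Ek) \<le> ?b * ?Em"
    using gap by (intro mult_left_mono) auto
  also have "\<dots> = ?a * ?Ek"
    using binomial_weight_step[of k m] k m by simp
  finally have "?b * exp (1 / (real n)\<^sup>2) \<le> ?a"
    using Epos by (simp only: mult.assoc[symmetric] mult_le_cancel_right_pos)
  also have "\<dots> \<le> exp (- ((real k - 1) / (real n)\<^sup>2)) * ?C"
    using step by simp
  also have "exp (- ((real k - 1) / (real n)\<^sup>2))
      = exp (- ((real (Suc k) - 1) / (real n)\<^sup>2)) * exp (1 / (real n)\<^sup>2)"
    by (simp add: exp_add[symmetric] diff_divide_distrib add_divide_distrib)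
  finally have "?b * exp (1 / (real n)\<^sup>2)
      \<le> (exp (- ((real (Suc k) - 1) / (real n)\<^sup>2)) * ?C) * exp (1 / (real n)\<^sup>2)"
    by (simp only: ac_simps)
  then show ?case by (simp only: mult_le_cancel_right_pos[OF exp_gt_zero])
qed

text \<open>Since \<open>exp x \<ge> 1 + x\<close>, it suffices that
  \<open>(1 - 5 * s / 6) * (1 + 11 * s / 12) > 1\<close>. The product is
  \<open>1 + s / 12 - 55 * s\<^sup>2 / 72\<close>, whence the threshold
  \<open>6 / 55\<close>.\<close>

lemma exp_uminus_less_linear:
  fixes s :: real
  assumes "0 < s" "s < 6 / 55"
  shows "exp (- (11 * s / 12)) < 1 - 5 * s / 6"
proof -
  have "s * s < s * (6 / 55)"
    using assms by (intro mult_strict_left_mono) auto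
  then have "1 < (1 - 5 * s / 6) * (1 + 11 * s / 12)"
    by (simp add: field_simps)
  also have "\<dots> \<le> (1 - 5 * s / 6) * exp (11 * s / 12)"
    using assms exp_ge_add_one_self[of "11 * s / 12"] by (intro mult_left_mono) auto
  finally show ?thesis
    by (simp add: exp_minus field_simps)
qed

theorem theorem2p1:
  fixes n k :: nat
  assumes "n \<ge> 4"
    and "k \<in> {2..nat \<lfloor>real n / 2\<rfloor>}"
  shows "real (n choose k)
           < exp (- (11 * (real k - 1) / (12 * real n ^ 2)))
               * (real n * (real n - 1) ^ (n - 1) / (real k ^ k * (real n - real k) ^ (n - k)))
       \<and> exp (- (11 * (real k - 1) / (12 * real n ^ 2)))
               * (real n * (real n - 1) ^ (n - 1) / (real k ^ k * (real n - real k) ^ (n - k)))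
           < (1 - 5 * (real k - 1) / (6 * real n ^ 2))
               * (real n * (real n - 1) ^ (n - 1) / (real k ^ k * (real n - real k) ^ (n - k)))"
proof -
  have k: "2 \<le> k" "2 * k \<le> n" using assms(2) by (auto simp: le_nat_iff le_floor_iff)
  define s where "s = (real k - 1) / (real n)\<^sup>2"
  define D where "D = real k ^ k * (real n - real k) ^ (n - k)"
  define C where "C = real n * (real n - 1) ^ (n - 1)"
  have pos: "0 < D" "0 < C" using k by (auto simp: D_def C_def)
  have s: "0 < s" using k by (simp add: s_def)
  \<comment> \<open>From \<open>(n - 4)\<^sup>2 \<ge> 0\<close> one gets
    \<open>n / 2 - 1 \<le> n\<^sup>2 / 16\<close>, so \<open>s \<le> 1 / 16\<close>. The value
    \<open>3 / 32\<close> is a convenient strict bound still below \<open>6 / 55\<close>.\<close>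
  have "real k - 1 < real n * real n / 32 * 3"
  proof -
    have "real k - 1 \<le> real n / 2 - 1" using k by simp
    also have "\<dots> < real n * real n / 32 * 3"
      using zero_le_power2[of "real n - 4"] assms(1) by (simp add: power2_eq_square field_simps)
    finally show ?thesis .
  qed
  then have "s < 3 / 32" using k by (simp add: s_def power2_eq_square field_simps)
  then have "exp (- (11 * s / 12)) < 1 - 5 * s / 6"
    using s by (intro exp_uminus_less_linear) auto
  then have second: "exp (- (11 * s / 12)) * (C / D) < (1 - 5 * s / 6) * (C / D)"
    using pos by (intro mult_strict_right_mono) auto
  have "real (n choose k) * D \<le> exp (- s) * C"
    using binomial_weight_bound[of k n] k
    by (simp add: s_def C_def D_def of_nat_diff mult.assoc)
  \<comment> \<open>Strictness comes from weakening the exponent \<open>s\<close> to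
    \<open>11 * s / 12\<close>, with \<open>s > 0\<close> because \<open>k \<ge> 2\<close>.\<close>
  also have "\<dots> < exp (- (11 * s / 12)) * C"
    using s pos by (intro mult_strict_right_mono) auto
  finally have "real (n choose k) < exp (- (11 * s / 12)) * (C / D)"
    using pos by (simp add: field_simps)
  with second show ?thesis
    by (simp add: s_def C_def D_def mult.commute)
qed

end
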